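(* For each integer dimension $d\ge 2$ and all real parameters $0<a<\ell$, the $d$-dimensional volume of the isocanted cube $\mathcal{I}_d(\ell,a)$ is equal to the determinant of the matrix $M_d(\ell,a)$, namely $$\operatorname{vol}_d \mathcal{I}_d(\ell,a)=r_d(\ell,a),\qquad r_d(\ell,a):=(\ell-a)^{d-1}(\ell+(d-1)a)=(\ell-a)^{d}+da(\ell-a)^{d-1}=\det M_d(\ell,a).$$
   Context: For an integer $d\ge2$ and real numbers $0<a<\ell$, the isocanted cube $\mathcal{I}_d(\ell,a)\subseteq\mathbb{R}^d$ is the convex polytope $$\mathcal{I}_d(\ell,a)=\Big\{x\in\mathbb{R}^d:\ -\tfrac{\ell}{2}\le x_j\le \tfrac{\ell}{2},\ \ a-\ell\le x_j-x_k\le \ell-a\ \text{ for all } j,k\in\{1,\dots,d\},\ j\ne k\Big\}.$$ $M_d(\ell,a):=(\ell-a)I_d+aJ_d$, where $I_d$ is the $d\times d$ identity matrix and $J_d$ is the $d\times d$ all-ones matrix; i.e. $M_d(\ell,a)$ is the $d\times d$ matrix with all diagonal entries equal to $\ell$ and all off-diagonal entries equal to $a$ (the Bose matrix). $\operatorname{vol}_d$ is $d$-dimensional Lebesgue measure. *)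

theory Defs
  imports "HOL-Analysis.Analysis"
begin

definition isocanted_cube :: "real \<Rightarrow> real \<Rightarrow> (real ^ 'n) set" where
  "isocanted_cube l a =
    {x. (\<forall>j. - l / 2 \<le> x $ j \<and> x $ j \<le> l / 2) \<and>
        (\<forall>j k. j \<noteq> k \<longrightarrow> a - l \<le> x $ j - x $ k \<and> x $ j - x $ k \<le> l - a)}"

definition bose_matrix :: "real \<Rightarrow> real \<Rightarrow> real ^ 'n ^ 'n" where
  "bose_matrix l a = (l - a) *\<^sub>R mat 1 + a *\<^sub>R (\<chi> i j. 1)"

lemma bose_matrix_nth: "bose_matrix l a $ i $ j = (if i = j then l else a)"
  by (simp add: bose_matrix_def mat_def)

definition r_vol :: "nat \<Rightarrow> real \<Rightarrow> real \<Rightarrow> real" where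
  "r_vol d l a = (l - a) ^ (d - 1) * (l + (real d - 1) * a)"

end

theory Submission
  imports Defs
begin

text \<open>
  Put \<open>c = l - a\<close>. Points of the isocanted cube whose coordinates are all at least \<open>l/2 - c\<close> form
  the cube \<open>[l/2 - c, l/2]\<^sup>d\<close>, of volume \<open>c\<^sup>d\<close>. The other points are divided according to the
  index \<open>i\<close> of a minimal coordinate: subtracting \<open>x\<^sub>i\<close> from all other coordinates is a shear that maps
  the \<open>i\<close>-th piece onto a box with one side \<open>a\<close> and \<open>d - 1\<close> sides \<open>c\<close>. The pieces overlap in null
  sets only. The matrix of the same shear conjugates the Bose matrix to a triangular one.
\<close>

section \<open>Determinants of the shear and of the Bose matrix\<close>

text \<open>Only the identity survives in the Leibniz expansion: a permutation fixing every index
  but \<open>i\<close> also fixes \<open>i\<close> by injectivity, so any other one moves some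
  \<open>k \<noteq> i\<close> and picks a zero in row \<open>k\<close>.\<close>

lemma det_diagonal_except_row:
  fixes v d :: "'n::finite \<Rightarrow> 'a::comm_ring_1"
  shows "det (\<chi> k j. if k = i then v j else if k = j then d k else 0) = v i * (\<Prod>k\<in>UNIV - {i}. d k)"
    (is "det ?A = _")
proof -
  have zero: "(\<Prod>k\<in>UNIV. ?A $ k $ p k) = 0" if p: "p permutes UNIV" and "p \<noteq> id" for p
  proof -
    obtain k where "k \<noteq> i" "p k \<noteq> k"
    proof (rule ccontr)
      assume "\<not> thesis"
      with that have fix_others: "p k = k" if "k \<noteq> i" for k using \<open>k \<noteq> i\<close> by blast
      have "inj p" using p by (rule permutes_inj)
      then have "p i = i" using fix_others by (metis injD)
      with fix_others have "p = id" by (metis eq_id_iff)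
      with \<open>p \<noteq> id\<close> show False ..
    qed
    then have "?A $ k $ p k = 0" by simp
    then show ?thesis by (meson UNIV_I finite prod_zero)
  qed
  have "det ?A = (\<Sum>p\<in>{id}. of_int (sign p) * (\<Prod>k\<in>UNIV. ?A $ k $ p k))"
    unfolding det_def
    by (rule sum.mono_neutral_right) (use zero in \<open>auto simp: permutes_id\<close>)
  also have "\<dots> = (\<Prod>k\<in>UNIV. if k = i then v k else d k)"
    by (auto simp: sign_id intro!: prod.cong)
  also have "\<dots> = v i * (\<Prod>k\<in>UNIV - {i}. d k)"
    by (subst prod.remove[of _ i]) (auto intro!: prod.cong)
  finally show ?thesis .
qed

text \<open>The inverse of subtracting coordinate \<open>i\<close> from all the others, so it
  carries boxes to pieces of the isocanted cube. Its column \<open>i\<close> is the all-ones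
  vector.\<close>

definition shear :: "'n::finite \<Rightarrow> real ^ 'n ^ 'n" where
  "shear i = (\<chi> k j. if j = i \<or> k = j then 1 else 0)"

lemma det_shear: "det (shear i) = 1"
proof -
  have "transpose (shear i) = (\<chi> k j. if k = i then 1 else if k = j then 1 else 0)"
    by (auto simp: shear_def transpose_def vec_eq_iff)
  then have "det (transpose (shear i)) = 1"
    by (simp only: det_diagonal_except_row) simp
  then show ?thesis by (simp add: det_transpose)
qed

lemma shear_mult_vec_nth: "(shear i *v y) $ k = (if k = i then y $ i else y $ k + y $ i)"
proof -
  have "(shear i *v y) $ k = (\<Sum>j\<in>UNIV. if j = i \<or> k = j then y $ j else 0)"
    by (auto simp: shear_def matrix_vector_mult_def intro!: sum.cong)
  also have "\<dots> = (\<Sum>j\<in>{i, k}. y $ j)"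
    by (rule sum.mono_neutral_cong_right) auto
  finally show ?thesis by (cases "k = i") (simp_all add: add.commute)
qed

text \<open>The columns of the shear are the all-ones vector \<open>e\<close>, an eigenvector for
  \<open>l + (d - 1) * a\<close>, and the unit vectors at \<open>q \<noteq> i\<close>, each sent to
  \<open>l - a\<close> times itself plus \<open>a\<close> times \<open>e\<close>. In this basis the
  Bose matrix becomes \<open>T\<close>, which is diagonal outside row \<open>i\<close>.\<close>

lemma det_bose_matrix: "det (bose_matrix l a :: real ^ 'n ^ 'n::finite) = r_vol CARD('n) l a"
proof -
  obtain i :: 'n where True by blast
  define d where "d = real CARD('n)"
  define v where "v = (\<lambda>j. if j = i then l + (d - 1) * a else a)"
  define T :: "real ^ 'n ^ 'n" where
    "T = (\<chi> k j. if k = i then v j else if k = j then l - a else 0)"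
  have "(bose_matrix l a ** shear i) $ p $ q = (shear i ** T) $ p $ q" for p q
  proof -
    have row: "(\<Sum>k\<in>UNIV. if p = k then l else a) = l + (d - 1) * a"
      by (subst sum.remove[of _ p]) (auto simp: d_def of_nat_diff)
    have "(bose_matrix l a ** shear i) $ p $ q =
        (\<Sum>k\<in>UNIV. if q = i \<or> k = q then if p = k then l else a else 0)"
      by (auto simp: matrix_matrix_mult_def shear_def bose_matrix_nth intro!: sum.cong)
    also have "\<dots> = (if q = i then l + (d - 1) * a else if p = q then l else a)"
      using row by auto
    also have "\<dots> = (if p = i then T $ i $ q else T $ p $ q + T $ i $ q)"
      by (auto simp: T_def v_def d_def algebra_simps)
    also have "\<dots> = (shear i *v (\<chi> k. T $ k $ q)) $ p"
      by (simp add: shear_mult_vec_nth)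
    also have "\<dots> = (shear i ** T) $ p $ q"
      by (simp add: matrix_vector_mult_def matrix_matrix_mult_def)
    finally show ?thesis .
  qed
  then have "bose_matrix l a ** shear i = shear i ** T"
    by (simp add: vec_eq_iff)
  then have "det (bose_matrix l a :: real ^ 'n ^ 'n) = det T"
    by (metis det_mul det_shear mult_1 mult_1_right)
  also have "\<dots> = v i * (l - a) ^ (CARD('n) - 1)"
    unfolding T_def det_diagonal_except_row by simp
  finally show ?thesis by (simp add: v_def d_def r_vol_def)
qed

lemma r_vol_eq:
  assumes "d \<ge> 1"
  shows "r_vol d l a = (l - a) ^ d + real d * a * (l - a) ^ (d - 1)"
proof -
  \<comment> \<open>The assumption \<open>d \<ge> 1\<close> keeps the natural number
    \<open>d - 1\<close> from being truncated.\<close>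
  have "(l - a) ^ d = (l - a) * (l - a) ^ (d - 1)"
    using assms by (metis Suc_pred' less_eq_Suc_le One_nat_def power_Suc)
  then show ?thesis by (simp add: r_vol_def algebra_simps)
qed

section \<open>Invariance of volume under the shear\<close>

text \<open>For a linear map it suffices to compare the measures of boxes and their images. For a
  box this is \<open>measure_shear_interval\<close>, once the box is suitably translated.\<close>

lemma
  fixes m n :: "'n::finite" and S :: "(real ^ 'n) set"
  assumes "m \<noteq> n" "S \<in> lmeasurable"
  defines "h \<equiv> \<lambda>x :: real ^ 'n. \<chi> k. if k = m then x $ m + x $ n else x $ k"
  shows lmeasurable_elementary_shear: "h ` S \<in> lmeasurable"
    and measure_elementary_shear: "measure lebesgue (h ` S) = measure lebesgue S"
proof -
  have lin: "linear h"
    unfolding h_def by (rule linearI) (auto simp: vec_eq_iff algebra_simps)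
  have "measure lebesgue (h ` cbox a b) = measure lebesgue (cbox a b)" for a b
  proof (cases "cbox a b = {}")
    case False
    \<comment> \<open>Translating by \<open>- w\<close> moves the lower bound in coordinate
      \<open>n\<close> to 0, since \<open>measure_shear_interval\<close> asks for it to be
      nonnegative.\<close>
    define w :: "real ^ 'n" where "w = axis n (a $ n)"
    have box: "cbox a b = (+) w ` cbox (a - w) (b - w)"
      by (simp flip: cbox_translation)
    have "h ` cbox a b = (+) (h w) ` h ` cbox (a - w) (b - w)"
      unfolding box image_comp o_def using linear_add[OF lin] by simp
    then have "measure lebesgue (h ` cbox a b) = measure lebesgue (h ` cbox (a - w) (b - w))"
      by (simp only: measure_translation)
    also have "\<dots> = measure lebesgue (cbox (a - w) (b - w))"
      unfolding h_def
      using measure_shear_interval[of m n "a - w" "b - w"] False assms(1) box by (auto simp: w_def)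
    also have "\<dots> = measure lebesgue (cbox a b)"
      unfolding box by (simp only: measure_translation)
    finally show ?thesis .
  qed simp
  then show "h ` S \<in> lmeasurable" "measure lebesgue (h ` S) = measure lebesgue S"
    using measure_linear_sufficient[OF lin assms(2), of 1] by auto
qed

text \<open>The change of variables theorem for linear maps is only available for well-ordered index types,
  so the shear is composed of elementary ones instead.\<close>

lemma
  fixes i :: "'n::finite" and S :: "(real ^ 'n) set"
  assumes S: "S \<in> lmeasurable"
  shows lmeasurable_shear: "(*v) (shear i) ` S \<in> lmeasurable"
    and measure_shear: "measure lebesgue ((*v) (shear i) ` S) = measure lebesgue S"
proof -
  define g :: "'n set \<Rightarrow> real ^ 'n \<Rightarrow> real ^ 'n" where
    "g K = (\<lambda>y. \<chi> k. if k \<in> K then y $ k + y $ i else y $ k)" for K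
  have "g K ` S \<in> lmeasurable \<and> measure lebesgue (g K ` S) = measure lebesgue S"
    if "i \<notin> K" for K
    using finite[of K] that
  proof (induction K rule: finite_induct)
    case empty
    then show ?case using S by (simp add: g_def)
  next
    case (insert m K)
    then have "m \<noteq> i" by blast
    \<comment> \<open>Since \<open>i\<close> and \<open>m\<close> lie outside \<open>K\<close>,
      \<open>g K\<close> leaves both coordinates unchanged, so the elementary shear still adds the
      original \<open>y $ i\<close> to the original \<open>y $ m\<close>.\<close>
    have "g (insert m K) = (\<lambda>x. \<chi> k. if k = m then x $ m + x $ i else x $ k) \<circ> g K"
      using insert.hyps insert.prems by (auto simp: g_def fun_eq_iff vec_eq_iff)
    then have "g (insert m K) ` S = (\<lambda>x. \<chi> k. if k = m then x $ m + x $ i else x $ k) ` g K ` S"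
      by (simp add: image_comp)
    with insert \<open>m \<noteq> i\<close> show ?case
      by (simp add: lmeasurable_elementary_shear measure_elementary_shear)
  qed
  moreover have "(*v) (shear i) = g (- {i})"
    by (auto simp: g_def fun_eq_iff vec_eq_iff shear_mult_vec_nth)
  ultimately show "(*v) (shear i) ` S \<in> lmeasurable"
    "measure lebesgue ((*v) (shear i) ` S) = measure lebesgue S"
    by auto
qed

section \<open>Decomposition of the isocanted cube and its volume\<close>

text \<open>The constraints bound \<open>x $ i\<close> and the differences
  \<open>x $ j - x $ i\<close> separately, so they describe a box in these coordinates. The bound
  \<open>l / 2\<close> on every coordinate follows from
  \<open>x $ i \<le> a - l / 2\<close>.\<close>

definition min_piece :: "real \<Rightarrow> real \<Rightarrow> 'n::finite \<Rightarrow> (real ^ 'n) set" where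
  "min_piece l a i = {x. - l / 2 \<le> x $ i \<and> x $ i \<le> a - l / 2 \<and>
                         (\<forall>j. x $ i \<le> x $ j \<and> x $ j \<le> x $ i + (l - a))}"

lemma min_piece_eq_shear_image:
  fixes i :: "'n::finite"
  assumes "a < l"
  shows "min_piece l a i = (*v) (shear i) `
    cbox (\<chi> j. if j = i then - l / 2 else 0) (\<chi> j. if j = i then a - l / 2 else l - a)"
    (is "_ = _ ` ?B")
proof (intro equalityI subsetI)
  fix x :: "real ^ 'n"
  assume x: "x \<in> min_piece l a i"
  define y where "y = (\<chi> j. if j = i then x $ i else x $ j - x $ i)"
  have "x = shear i *v y"
    by (simp add: vec_eq_iff shear_mult_vec_nth y_def)
  moreover have "y \<in> ?B"
    using x by (auto simp: min_piece_def mem_box_cart y_def algebra_simps)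
  ultimately show "x \<in> (*v) (shear i) ` ?B" by blast
next
  fix x :: "real ^ 'n"
  assume "x \<in> (*v) (shear i) ` ?B"
  then obtain y where x: "x = shear i *v y" and y: "y \<in> ?B" by blast
  have "- l / 2 \<le> y $ i" "y $ i \<le> a - l / 2"
    using y[unfolded mem_box_cart, rule_format, of i] by auto
  moreover have "0 \<le> y $ j \<and> y $ j \<le> l - a" if "j \<noteq> i" for j
    using y[unfolded mem_box_cart, rule_format, of j] that by auto
  \<comment> \<open>For \<open>j = i\<close> the upper bound reads \<open>0 \<le> l - a\<close>,
    which is where \<open>a < l\<close> enters.\<close>
  ultimately show "x \<in> min_piece l a i"
    using assms by (auto simp: min_piece_def x shear_mult_vec_nth)
qed

lemma
  fixes i :: "'n::finite"
  assumes "0 < a" "a < l"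
  shows lmeasurable_min_piece: "min_piece l a i \<in> lmeasurable"
    and measure_min_piece: "measure lebesgue (min_piece l a i) = a * (l - a) ^ (CARD('n) - 1)"
proof -
  define u v :: "real ^ 'n" where "u = (\<chi> j. if j = i then - l / 2 else 0)"
    and "v = (\<chi> j. if j = i then a - l / 2 else l - a)"
  have im: "min_piece l a i = (*v) (shear i) ` cbox u v"
    unfolding u_def v_def by (rule min_piece_eq_shear_image[OF assms(2)])
  show "min_piece l a i \<in> lmeasurable"
    unfolding im by (intro lmeasurable_shear) auto
  \<comment> \<open>The lower corner witnesses that the box is nonempty, as the product formula for
    its content requires.\<close>
  have "u \<in> cbox u v"
    using assms by (auto simp: mem_box_cart u_def v_def)
  then have "measure lebesgue (cbox u v) = (\<Prod>j\<in>UNIV. v $ j - u $ j)"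
    by (subst measure_completion) (auto intro: content_cbox_cart)
  also have "\<dots> = a * (l - a) ^ (CARD('n) - 1)"
    by (subst prod.remove[of _ i]) (auto simp: u_def v_def)
  finally show "measure lebesgue (min_piece l a i) = a * (l - a) ^ (CARD('n) - 1)"
    unfolding im by (simp add: measure_shear)
qed

text \<open>This is the hyperplane through 0 with nonzero normal \<open>axis i 1 - axis k 1\<close>;
  it contains the overlap of pieces \<open>i\<close> and \<open>k\<close>.\<close>

lemma negligible_coord_eq:
  assumes "i \<noteq> k"
  shows "negligible {x :: real ^ 'n::finite. x $ i = x $ k}"
proof -
  have "axis i 1 \<noteq> (axis k 1 :: real ^ 'n)" using assms by (simp add: axis_eq_axis)
  then have "negligible {x. (axis i 1 - axis k 1 :: real ^ 'n) \<bullet> x = 0}"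
    by (intro negligible_hyperplane) simp
  then show ?thesis by (simp add: inner_diff_left inner_axis')
qed

text \<open>A minimal coordinate is either at most \<open>a - l / 2\<close>, which gives a piece, or
  above it, which puts all coordinates in the small cube. Conversely, in a piece or in the small
  cube all coordinates lie in a common interval of length \<open>l - a\<close> inside
  \<open>[- l / 2, l / 2]\<close>.\<close>

lemma isocanted_cube_eq_pieces:
  assumes "0 < a" "a < l"
  shows "(isocanted_cube l a :: (real ^ 'n::finite) set) =
    (\<Union>i. min_piece l a i) \<union> cbox (\<chi> j. a - l / 2) (\<chi> j. l / 2)" (is "_ = ?U \<union> ?C")
proof (intro equalityI subsetI)
  fix x :: "real ^ 'n"
  assume x: "x \<in> isocanted_cube l a"
  have "Min (range (($) x)) \<in> range (($) x)"
    by (rule Min_in) auto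
  then obtain i where "x $ i = Min (range (($) x))"
    by (metis imageE)
  then have i: "x $ i \<le> x $ j" for j
    by simp
  have bounds: "- l / 2 \<le> x $ j" "x $ j \<le> l / 2" for j
    using x by (auto simp: isocanted_cube_def)
  \<comment> \<open>The cube bounds differences of distinct coordinates only; \<open>j = i\<close>
    needs \<open>a < l\<close>.\<close>
  have "x $ j \<le> x $ i + (l - a)" for j
    using x assms by (cases "j = i") (auto simp: isocanted_cube_def algebra_simps)
  then have "x \<in> min_piece l a i" if "x $ i \<le> a - l / 2"
    using that i bounds by (simp add: min_piece_def)
  moreover have "x \<in> ?C" if "\<not> x $ i \<le> a - l / 2"
    using that i bounds by (simp add: mem_box_cart) (meson linear order_trans)
  ultimately show "x \<in> ?U \<union> ?C" by blast
next
  fix x :: "real ^ 'n"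
  assume "x \<in> ?U \<union> ?C"
  then consider i where "x \<in> min_piece l a i" | "x \<in> ?C" by blast
  then show "x \<in> isocanted_cube l a"
  proof cases
    case 1
    then have *: "x $ i \<le> x $ j" "x $ j \<le> x $ i + (l - a)"
      and "- l / 2 \<le> x $ i" "x $ i \<le> a - l / 2" for j
      by (auto simp: min_piece_def)
    have "- l / 2 \<le> x $ j \<and> x $ j \<le> l / 2 \<and> a - l \<le> x $ j - x $ k \<and> x $ j - x $ k \<le> l - a"
      for j k using *[of j] *[of k] \<open>- l / 2 \<le> x $ i\<close> \<open>x $ i \<le> a - l / 2\<close> by (intro conjI; linarith)
    then show ?thesis by (simp add: isocanted_cube_def)
  next
    case 2
    then have *: "a - l / 2 \<le> x $ j" "x $ j \<le> l / 2" for j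
      by (auto simp: mem_box_cart)
    have "- l / 2 \<le> x $ j \<and> x $ j \<le> l / 2 \<and> a - l \<le> x $ j - x $ k \<and> x $ j - x $ k \<le> l - a"
      for j k using *[of j] *[of k] assms by (intro conjI; linarith)
    then show ?thesis by (simp add: isocanted_cube_def)
  qed
qed

lemma measure_isocanted_cube:
  assumes "0 < a" "a < l"
  shows "measure lebesgue (isocanted_cube l a :: (real ^ 'n::finite) set) =
    (l - a) ^ CARD('n) + real CARD('n) * a * (l - a) ^ (CARD('n) - 1)"
proof -
  define U C :: "(real ^ 'n) set" where "U = (\<Union>i. min_piece l a i)"
    and "C = cbox (\<chi> j. a - l / 2) (\<chi> j. l / 2)"
  \<comment> \<open>On the overlap \<open>x $ i\<close> and \<open>x $ k\<close> are both minimal,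
    hence equal.\<close>
  have "negligible (min_piece l a i \<inter> min_piece l a k)" if "i \<noteq> k" for i k :: 'n
    by (rule negligible_subset[OF negligible_coord_eq[OF that]])
      (auto simp: min_piece_def intro: order_antisym)
  then have U: "measure lebesgue U = real CARD('n) * (a * (l - a) ^ (CARD('n) - 1))"
    unfolding U_def
    by (subst measure_negligible_finite_Union_image)
      (auto simp: pairwise_def lmeasurable_min_piece measure_min_piece assms)
  have "(\<chi> j. l / 2) \<in> C"
    using assms by (auto simp: mem_box_cart C_def)
  then have C: "measure lebesgue C = (l - a) ^ CARD('n)"
    unfolding C_def by (subst measure_completion) (auto simp: content_cbox_if_cart)
  have "negligible {x :: real ^ 'n. x $ i = a - l / 2}" for i
    using negligible_hyperplane[of "axis i 1 :: real ^ 'n"] by (simp add: inner_axis')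
  then have "negligible (\<Union>i. {x :: real ^ 'n. x $ i = a - l / 2})"
    by (intro negligible_Union) auto
  \<comment> \<open>Piece \<open>i\<close> has \<open>x $ i \<le> a - l / 2\<close> and the small
    cube has the reverse inequality, so they meet in a hyperplane only.\<close>
  moreover have "U \<inter> C \<subseteq> (\<Union>i. {x. x $ i = a - l / 2})"
  proof
    fix x assume "x \<in> U \<inter> C"
    then obtain i where "x \<in> min_piece l a i" "x \<in> C"
      by (auto simp: U_def)
    then have "x $ i \<le> a - l / 2" "a - l / 2 \<le> x $ i"
      by (auto simp: C_def min_piece_def mem_box_cart)
    then have "x $ i = a - l / 2" by (rule order_antisym)
    then show "x \<in> (\<Union>i. {x. x $ i = a - l / 2})" by blast
  qed
  ultimately have "measure lebesgue (U \<inter> C) = 0"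
    using negligible_imp_measure0 negligible_subset by blast
  moreover have "U \<in> lmeasurable"
    unfolding U_def by (rule fmeasurable.finite_UN) (simp_all add: lmeasurable_min_piece[OF assms])
  moreover have "C \<in> lmeasurable"
    unfolding C_def by (rule lmeasurable_cbox)
  ultimately have "measure lebesgue (U \<union> C) = measure lebesgue U + measure lebesgue C"
    by (simp add: measure_Un3)
  also have "U \<union> C = isocanted_cube l a"
    unfolding isocanted_cube_eq_pieces[OF assms] U_def C_def ..
  finally show ?thesis
    by (simp add: U C)
qed

theorem theorem3p1:
  fixes l a :: real
  assumes "CARD('n::finite) \<ge> 2" and "0 < a" and "a < l"
  shows "measure lebesgue (isocanted_cube l a :: (real ^ 'n) set) = r_vol CARD('n) l a \<and>
         r_vol CARD('n) l a
           = (l - a) ^ CARD('n) + real CARD('n) * a * (l - a) ^ (CARD('n) - 1) \<and>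
         r_vol CARD('n) l a = det (bose_matrix l a :: real ^ 'n ^ 'n)"
  using assms by (simp add: measure_isocanted_cube det_bose_matrix r_vol_eq)

end
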